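(* Let $p\in(1,\infty)$. The function $$f(x)=\frac{\log(\sinh_p(x)/x)}{\log\cosh_p(x)}$$ is strictly increasing from $(0,\infty)$ onto $(1/(1+p),1)$. In particular, for all $p\in(1,\infty)$ and $x\in(0,\infty)$, $$\cosh_p(x)^{\alpha}<\frac{\sinh_p(x)}{x}<\cosh_p(x)^{\beta}$$ with $\alpha=1/(1+p)$ and $\beta=1$, and these constants are best possible (i.e. $1/(1+p)$ is the largest real $\alpha$, and $1$ is the smallest real $\beta$, for which the respective inequality holds for all $x>0$).
   Context: For $1<p<\infty$ define $\mathrm{arcsinh}_p(x)=\int_0^x (1+t^p)^{-1/p}\,dt$ for $x\ge 0$. The generalized hyperbolic sine $\sinh_p:[0,\infty)\to[0,\infty)$ is the inverse of $\mathrm{arcsinh}_p$, and the generalized hyperbolic cosine is $\cosh_p(x)=\frac{d}{dx}\sinh_p(x)$; it satisfies $\cosh_p(x)^p-\sinh_p(x)^p=1$ for $x\ge0$. *)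

theory Defs
  imports "HOL-Analysis.Analysis"
begin

definition arcsinh_p :: "real \<Rightarrow> real \<Rightarrow> real" where
  "arcsinh_p p x = integral {0..x} (\<lambda>t. (1 + t powr p) powr (-1 / p))"

(* Only meaningful for arguments in {0..}, where arcsinh_p p is a bijection onto {0..} if p > 1. *)
definition sinh_p :: "real \<Rightarrow> real \<Rightarrow> real" where
  "sinh_p p = the_inv_into {0..} (arcsinh_p p)"

(* The derivative is taken within {0..}, the domain of sinh_p p: one-sided at 0,
   the ordinary derivative at every x > 0. *)
definition cosh_p :: "real \<Rightarrow> real \<Rightarrow> real" where
  "cosh_p p x = vector_derivative (sinh_p p) (at x within {0..})"

end

theory Submission
  imports Defs
begin

text \<open>With \<open>s = sinh_p x\<close>, \<open>A = arcsinh_p s\<close> and \<open>q = (1 + s powr p) powr (1 / p) = cosh_p x\<close>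
  the function is \<open>ln (s / A) / ln q\<close>. The monotone form of l'Hopital's rule applies twice at
  \<open>0\<close>: the first quotient of derivatives is \<open>(A - s / q) / (s powr p / (1 + s powr p) * A)\<close>,
  the second one is \<open>1 / (1 + p / ((s / A) * (1 + s powr p) powr (1 - 1 / p)))\<close>, which increases
  because \<open>s / A\<close> does. The same quotients give the limit \<open>1 / (1 + p)\<close> at \<open>0\<close>, and the first
  one gives the limit \<open>1\<close> at infinity. The sharpness of the constants is read off the range.\<close>

section \<open>Monotonicity of quotients and ranges of monotone functions on a half-line\<close>

text \<open>The right limit stands in for the value at \<open>a\<close>, so the lemma also covers
  functions whose formula degenerates there.\<close>

lemma pos_of_deriv_pos_at_right:
  fixes f f' :: "real \<Rightarrow> real"
  assumes lim: "(f \<longlongrightarrow> 0) (at_right a)" and ab: "a < b"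
    and der: "\<And>x. a < x \<Longrightarrow> x \<le> b \<Longrightarrow> (f has_real_derivative f' x) (at x)"
    and pos: "\<And>x. a < x \<Longrightarrow> x < b \<Longrightarrow> 0 < f' x"
  shows "0 < f b"
proof -
  have less: "f x < f y" if "a < x" "x < y" "y \<le> b" for x y
  proof (rule DERIV_pos_imp_increasing_open[OF \<open>x < y\<close>])
    show "\<exists>d. (f has_real_derivative d) (at z) \<and> 0 < d" if "x < z" "z < y" for z
      using der[of z] pos[of z] that \<open>a < x\<close> \<open>y \<le> b\<close> by auto
    show "continuous_on {x..y} f"
      by (rule DERIV_continuous_on[of _ _ f'], rule has_field_derivative_at_within)
        (use der \<open>a < x\<close> \<open>y \<le> b\<close> in auto)
  qed
  \<comment> \<open>Passing to the limit yields only the weak bound \<open>0 \<le> f m\<close>; the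
    growth from \<open>m\<close> to \<open>b\<close> restores strictness.\<close>
  define m where "m = (a + b) / 2"
  have m: "a < m" "m < b" using ab by (auto simp: m_def)
  have "\<forall>\<^sub>F x in at_right a. f x \<le> f m"
    using eventually_at_right_real[OF m(1)] less m by (force elim: eventually_mono intro: less_imp_le)
  then have "0 \<le> f m"
    by (intro tendsto_upperbound[OF lim]) auto
  then show ?thesis using less[of m b] m by simp
qed

text \<open>If \<open>r = f' / g'\<close> increases, then \<open>r b * g - f\<close> increases up to \<open>b\<close>,
  so \<open>r * g > f\<close>, and this is the sign of the derivative of \<open>f / g\<close>.\<close>

lemma strict_mono_on_quotient_of_deriv_quotient:
  fixes f g f' g' :: "real \<Rightarrow> real"
  assumes limf: "(f \<longlongrightarrow> 0) (at_right a)" and limg: "(g \<longlongrightarrow> 0) (at_right a)"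
    and derf: "\<And>x. a < x \<Longrightarrow> (f has_real_derivative f' x) (at x)"
    and derg: "\<And>x. a < x \<Longrightarrow> (g has_real_derivative g' x) (at x)"
    and pos: "\<And>x. a < x \<Longrightarrow> 0 < g' x"
    and mono: "strict_mono_on {a<..} (\<lambda>x. f' x / g' x)"
  shows "strict_mono_on {a<..} (\<lambda>x. f x / g x)"
proof -
  have g: "0 < g x" if "a < x" for x
    by (rule pos_of_deriv_pos_at_right[OF limg that, of g']) (use derg pos in auto)
  have f: "f b < f' b / g' b * g b" if "a < b" for b
  proof -
    define r where "r = f' b / g' b"
    have "0 < r * g b - f b"
    proof (rule pos_of_deriv_pos_at_right[OF _ that, of "\<lambda>x. r * g x - f x" "\<lambda>x. r * g' x - f' x"])
      show "((\<lambda>x. r * g x - f x) \<longlongrightarrow> 0) (at_right a)"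
        using tendsto_diff[OF tendsto_mult_left[OF limg] limf] by simp
      show "((\<lambda>x. r * g x - f x) has_real_derivative r * g' x - f' x) (at x)" if "a < x" for x
        using derf[OF that] derg[OF that] by (auto intro!: derivative_eq_intros)
      show "0 < r * g' x - f' x" if "a < x" "x < b" for x
      proof -
        have "f' x / g' x < r"
          using strict_mono_onD[OF mono, of x b] that by (simp add: r_def)
        then show ?thesis using pos[OF that(1)] by (simp add: field_simps)
      qed
    qed
    then show ?thesis by (simp add: r_def)
  qed
  have der: "((\<lambda>x. f x / g x) has_real_derivative
      g' x / (g x)\<^sup>2 * (f' x / g' x * g x - f x)) (at x)" if "a < x" for x
    using derf[OF that] derg[OF that] g[OF that] pos[OF that]
    by (auto intro!: derivative_eq_intros simp: field_simps power2_eq_square)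
  have dpos: "0 < g' x / (g x)\<^sup>2 * (f' x / g' x * g x - f x)" if "a < x" for x
    using f[OF that] g[OF that] pos[OF that] by simp
  show ?thesis
  proof (rule strict_mono_onI)
    fix x y assume "x \<in> {a<..}" "y \<in> {a<..}" "x < y"
    then have "\<exists>d. ((\<lambda>x. f x / g x) has_real_derivative d) (at z) \<and> 0 < d" if "x \<le> z" for z
      using der[of z] dpos[of z] that by auto
    then show "f x / g x < f y / g y"
      by (rule DERIV_pos_imp_increasing[OF \<open>x < y\<close>])
  qed
qed

text \<open>Limits bound values only weakly; strictness comes from comparing \<open>f x\<close> with
  the values at \<open>m < x\<close> and at \<open>x + 1\<close>. Conversely, a \<open>y\<close>
  strictly between the limits is passed by \<open>f\<close> on the way from near \<open>a\<close> to
  far out, hence is attained by the intermediate value theorem.\<close>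

lemma strict_mono_on_image_greaterThan:
  fixes f :: "real \<Rightarrow> real"
  assumes mono: "strict_mono_on {a<..} f" and cont: "continuous_on {a<..} f"
    and lim: "(f \<longlongrightarrow> l) (at_right a)" "(f \<longlongrightarrow> u) at_top"
  shows "f ` {a<..} = {l<..<u}"
proof (intro equalityI subsetI)
  fix y assume "y \<in> f ` {a<..}"
  then obtain x where x: "a < x" "y = f x" by auto
  define m where "m = (a + x) / 2"
  have m: "a < m" "m < x" using x by (auto simp: m_def)
  have "\<forall>\<^sub>F z in at_right a. f z \<le> f m"
    using eventually_at_right_real[OF m(1)]
    by eventually_elim (use m in \<open>auto intro!: less_imp_le[OF strict_mono_onD[OF mono]]\<close>)
  then have "l \<le> f m" by (intro tendsto_upperbound[OF lim(1)]) auto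
  moreover have "f m < f x" using m x by (intro strict_mono_onD[OF mono]) auto
  moreover have "\<forall>\<^sub>F z in at_top. f (x + 1) \<le> f z"
    using eventually_gt_at_top[of "x + 1"]
    by eventually_elim (use x in \<open>auto intro!: less_imp_le[OF strict_mono_onD[OF mono]]\<close>)
  then have "f (x + 1) \<le> u" by (intro tendsto_lowerbound[OF lim(2)]) auto
  moreover have "f x < f (x + 1)" using x by (intro strict_mono_onD[OF mono]) auto
  ultimately show "y \<in> {l<..<u}" using x by simp
next
  fix y assume y: "y \<in> {l<..<u}"
  have "\<forall>\<^sub>F z in at_right a. f z < y" "\<forall>\<^sub>F z in at_top. y < f z"
    using order_tendstoD[OF lim(1)] order_tendstoD[OF lim(2)] y by auto
  moreover from this(1) have "\<forall>\<^sub>F z in at_right a. f z < y \<and> a < z"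
    by (rule eventually_conj) (rule eventually_at_right_less)
  ultimately obtain v where v: "a < v" "f v < y"
    using eventually_happens[of _ "at_right a"] by force
  have "\<forall>\<^sub>F z in at_top. y < f z \<and> v < z"
    by (intro eventually_conj eventually_gt_at_top) fact
  then obtain w where w: "v < w" "y < f w"
    using eventually_happens[of _ "at_top :: real filter"] by force
  have "continuous_on {v..w} f" by (rule continuous_on_subset[OF cont]) (use v in auto)
  then obtain z where "v \<le> z" "f z = y"
    using IVT'[of f v y w] v w by auto
  then show "y \<in> f ` {a<..}" using v by auto
qed

section \<open>The function \<open>arcsinh_p\<close>, its inverse, and the derivative of the
  inverse\<close>

context
  fixes p :: real
  assumes p: "1 < p"
begin

lemma arcsinh_p_integrand_continuous:
  "continuous_on {0..b} (\<lambda>t. (1 + t powr p) powr (-1 / p))"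
proof -
  have "continuous_on {0..b} (\<lambda>t. t powr p)"
    using p by (intro continuous_on_powr' continuous_intros) auto
  moreover have "1 + t powr p \<noteq> 0" for t
    by (smt (verit) powr_ge_zero)
  ultimately show ?thesis
    by (auto intro!: continuous_on_powr continuous_on_add continuous_on_const)
qed

lemma arcsinh_p_0 [simp]: "arcsinh_p p 0 = 0"
  by (simp add: arcsinh_p_def)

lemma continuous_on_arcsinh_p: "continuous_on {0..b} (arcsinh_p p)"
  unfolding arcsinh_p_def
  by (rule indefinite_integral_continuous_1)
    (rule integrable_continuous_real[OF arcsinh_p_integrand_continuous])

lemma arcsinh_p_has_real_derivative:
  assumes "0 < x"
  shows "(arcsinh_p p has_real_derivative (1 + x powr p) powr (-1 / p)) (at x)"
proof -
  \<comment> \<open>The endpoint \<open>x + 1\<close> serves to make \<open>x\<close> an interior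
    point, so that the derivative within the interval is the full derivative.\<close>
  have "(arcsinh_p p has_real_derivative (1 + x powr p) powr (-1 / p)) (at x within {0..x + 1})"
    unfolding arcsinh_p_def
    by (rule integral_has_real_derivative[OF arcsinh_p_integrand_continuous]) (use assms in auto)
  moreover have "at x within {0..x + 1} = at x"
    by (rule at_within_interior) (use assms in auto)
  ultimately show ?thesis by simp
qed

lemmas arcsinh_p_deriv [derivative_intros] =
  DERIV_chain2[OF arcsinh_p_has_real_derivative]

lemma one_plus_powr_pos [simp]: "0 < 1 + (x::real) powr p"
  by (smt (verit) powr_ge_zero)

lemma arcsinh_p_tendsto_0: "(arcsinh_p p \<longlongrightarrow> 0) (at_right 0)"
proof -
  have "(arcsinh_p p \<longlongrightarrow> arcsinh_p p 0) (at 0 within {0..1})"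
    using continuous_on_arcsinh_p[of 1] unfolding continuous_on_def by (rule bspec) simp
  then show ?thesis by (simp add: at_within_Icc_at_right)
qed

lemma arcsinh_p_pos:
  assumes "0 < x" shows "0 < arcsinh_p p x"
  by (rule pos_of_deriv_pos_at_right[OF arcsinh_p_tendsto_0 assms
        arcsinh_p_has_real_derivative]) (auto simp: less_imp_neq[symmetric])

lemma arcsinh_p_strict_mono: "strict_mono_on {0..} (arcsinh_p p)"
proof (rule strict_mono_onI)
  fix x y :: real assume "x \<in> {0..}" "y \<in> {0..}" "x < y"
  show "arcsinh_p p x < arcsinh_p p y"
  proof (rule DERIV_pos_imp_increasing_open[OF \<open>x < y\<close>])
    show "\<exists>d. (arcsinh_p p has_real_derivative d) (at z) \<and> 0 < d" if "x < z" for z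
    proof (intro exI conjI)
      show "(arcsinh_p p has_real_derivative (1 + z powr p) powr (-1 / p)) (at z)"
        using arcsinh_p_has_real_derivative[of z] that \<open>x \<in> {0..}\<close> by simp
      show "0 < (1 + z powr p) powr (-1 / p)"
        using one_plus_powr_pos[of z] by (simp add: less_imp_neq[symmetric])
    qed
    show "continuous_on {x..y} (arcsinh_p p)"
      by (rule continuous_on_subset[OF continuous_on_arcsinh_p[of y]]) (use \<open>x \<in> {0..}\<close> in auto)
  qed
qed

text \<open>For \<open>t \<ge> 1\<close> the integrand is at least \<open>2 powr (-1 / p) / t\<close>.\<close>

lemma filterlim_arcsinh_p: "filterlim (arcsinh_p p) at_top at_top"
proof -
  define c where "c = 2 powr (-1 / p)"
  have c: "0 < c" by (simp add: c_def)
  have "filterlim (\<lambda>x. c * ln x) at_top at_top"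
    by (rule filterlim_tendsto_pos_mult_at_top[OF tendsto_const c ln_at_top])
  moreover have "c * ln x \<le> arcsinh_p p x" if "1 \<le> x" for x
  proof -
    \<comment> \<open>At \<open>1\<close> the logarithm vanishes and \<open>arcsinh_p p 1\<close> is
      positive, so it suffices that the difference does not decrease on
      \<open>[1, x]\<close>.\<close>
    have "arcsinh_p p 1 - c * ln 1 \<le> arcsinh_p p x - c * ln x"
    proof (rule DERIV_nonneg_imp_nondecreasing[OF that])
      fix t :: real assume t: "1 \<le> t"
      have "((\<lambda>x. arcsinh_p p x - c * ln x) has_real_derivative
          (1 + t powr p) powr (-1 / p) - c / t) (at t)"
        using t by (auto intro!: derivative_eq_intros)
      moreover have "c / t \<le> (1 + t powr p) powr (-1 / p)"
      proof -
        have "c / t = (2 * t powr p) powr (-1 / p)"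
          using p t by (simp add: c_def powr_mult powr_powr powr_minus_divide)
        \<comment> \<open>Since \<open>t \<ge> 1\<close>,
          \<open>1 + t powr p \<le> 2 * t powr p\<close>, and the negative exponent reverses the
          inequality.\<close>
        also have "\<dots> \<le> (1 + t powr p) powr (-1 / p)"
          using p t by (intro powr_mono2') (auto simp: ge_one_powr_ge_zero)
        finally show ?thesis .
      qed
      ultimately show "\<exists>d. ((\<lambda>x. arcsinh_p p x - c * ln x) has_real_derivative d) (at t) \<and> 0 \<le> d"
        by auto
    qed
    then show ?thesis using arcsinh_p_pos[of 1] by simp
  qed
  then have "\<forall>\<^sub>F x in at_top. c * ln x \<le> arcsinh_p p x"
    using eventually_ge_at_top[of 1] by (rule eventually_mono[rotated])
  ultimately show ?thesis by (rule filterlim_at_top_mono)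
qed

text \<open>Strict monotonicity gives injectivity. Divergence at infinity supplies a
  \<open>b\<close> with value at least \<open>y\<close>, and the intermediate value theorem on
  \<open>[0, b]\<close> gives surjectivity.\<close>

lemma arcsinh_p_bij: "bij_betw (arcsinh_p p) {0..} {0..}"
  unfolding bij_betw_def
proof (intro conjI equalityI subsetI)
  show "inj_on (arcsinh_p p) {0..}"
    by (rule strict_mono_on_imp_inj_on[OF arcsinh_p_strict_mono])
  show "y \<in> {0..}" if "y \<in> arcsinh_p p ` {0..}" for y
    using that arcsinh_p_pos by (force simp: le_less)
  show "y \<in> arcsinh_p p ` {0..}" if "y \<in> {0..}" for y
  proof -
    have "\<forall>\<^sub>F x in at_top. y \<le> arcsinh_p p x \<and> 0 \<le> x"
      using filterlim_arcsinh_p eventually_ge_at_top[of 0]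
      by (auto simp: filterlim_at_top eventually_conj)
    then obtain b where "y \<le> arcsinh_p p b" "0 \<le> b"
      using eventually_happens[of _ "at_top :: real filter"] by force
    then show ?thesis
      using IVT'[of "arcsinh_p p" 0 y b] continuous_on_arcsinh_p that by force
  qed
qed

lemma sinh_p_arcsinh_p: "0 \<le> s \<Longrightarrow> sinh_p p (arcsinh_p p s) = s"
  unfolding sinh_p_def using arcsinh_p_bij by (auto simp: bij_betw_def the_inv_into_f_f)

text \<open>By the inverse function rule the derivative of \<open>sinh_p p\<close> is the reciprocal
  of the integrand at \<open>s\<close>. Parametrizing by \<open>s\<close> makes
  \<open>cosh_p\<close> explicit, so the rest of the argument can be carried out in
  \<open>s\<close>.\<close>

lemma cosh_p_arcsinh_p:
  assumes s: "0 < s"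
  shows "cosh_p p (arcsinh_p p s) = (1 + s powr p) powr (1 / p)"
proof -
  define x where "x = arcsinh_p p s"
  have x: "0 < x" using s by (simp add: x_def arcsinh_p_pos)
  have inv: "arcsinh_p p (sinh_p p y) = y" "0 \<le> sinh_p p y" if "0 \<le> y" for y
    using arcsinh_p_bij that f_the_inv_into_f_bij_betw[OF arcsinh_p_bij]
      bij_betwE[OF bij_betw_the_inv_into[OF arcsinh_p_bij]] by (auto simp: sinh_p_def)
  have sx: "sinh_p p x = s" using s by (simp add: x_def sinh_p_arcsinh_p)
  have "isCont (sinh_p p) (arcsinh_p p s)"
  \<comment> \<open>The radius \<open>s / 2\<close> keeps the neighbourhood of \<open>s\<close>
    inside the positive reals, where \<open>sinh_p p\<close> is known to invert
    \<open>arcsinh_p p\<close>.\<close>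
  proof (rule isCont_inverse_function[where x = s and d = "s / 2"])
    show "0 < s / 2" using s by simp
    fix z assume z: "\<bar>z - s\<bar> \<le> s / 2"
    then have "0 < z" using s by linarith
    then show "sinh_p p (arcsinh_p p z) = z" "isCont (arcsinh_p p) z"
      by (auto intro!: sinh_p_arcsinh_p DERIV_isCont[OF arcsinh_p_has_real_derivative])
  qed
  then have cont: "isCont (sinh_p p) x" by (simp add: x_def)
  have "(sinh_p p has_real_derivative inverse ((1 + s powr p) powr (-1 / p))) (at x)"
  proof (intro DERIV_inverse_function[where f = "arcsinh_p p" and a = 0 and b = "x + 1"])
    show "(arcsinh_p p has_real_derivative (1 + s powr p) powr (-1 / p)) (at (sinh_p p x))"
      using arcsinh_p_has_real_derivative[OF s] by (simp add: sx)
    show "(1 + s powr p) powr (-1 / p) \<noteq> 0"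
      using one_plus_powr_pos[of s] by (simp add: less_imp_neq[symmetric])
    show "arcsinh_p p (sinh_p p y) = y" if "0 < y" for y using inv that by simp
  qed (use x cont in auto)
  then have "(sinh_p p has_vector_derivative (1 + s powr p) powr (1 / p)) (at x)"
    by (simp add: has_real_derivative_iff_has_vector_derivative powr_minus)
  \<comment> \<open>\<open>cosh_p\<close> is defined by the derivative within \<open>{0..}\<close>,
    which at an interior point is the ordinary one.\<close>
  moreover have "at x within {0..} = at x"
    by (rule at_within_interior) (use x in auto)
  ultimately show ?thesis
    by (simp add: cosh_p_def x_def vector_derivative_at)
qed


section \<open>The hyperbolic cosine and the ratio \<open>s / arcsinh_p p s\<close> in the variable
  \<open>s\<close>\<close>

text \<open>For \<open>s > 0\<close> this is \<open>cosh_p\<close> at \<open>arcsinh_p p s\<close>,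
  that is, the cosine expressed through the sine.\<close>

definition hypot_p :: "real \<Rightarrow> real" where
  "hypot_p s = (1 + s powr p) powr (1 / p)"

lemma hypot_p_gt_1: "0 < s \<Longrightarrow> 1 < hypot_p s"
  using p by (simp add: hypot_p_def)

lemma le_hypot_p:
  assumes "0 < s" shows "s \<le> hypot_p s"
proof -
  have "s = (s powr p) powr (1 / p)" using assms p by (simp add: powr_powr)
  also have "\<dots> \<le> hypot_p s" unfolding hypot_p_def using p by (intro powr_mono2) auto
  finally show ?thesis .
qed

lemma hypot_p_has_real_derivative:
  assumes "0 < s"
  shows "(hypot_p has_real_derivative hypot_p s * s powr p / (s * (1 + s powr p))) (at s)"
proof -
  \<comment> \<open>The power rule result is rewritten with \<open>hypot_p s\<close> and
    \<open>s powr p\<close> as the only powers, so that later identities are rational in these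
    atoms.\<close>
  have "(1 + s powr p) powr (1 / p - 1) * (s powr (p - 1)) = hypot_p s * s powr p / (s * (1 + s powr p))"
    using assms by (simp add: hypot_p_def powr_diff)
  moreover have "(hypot_p has_real_derivative (1 + s powr p) powr (1 / p - 1) * (s powr (p - 1))) (at s)"
    using assms p unfolding hypot_p_def[abs_def] by (auto intro!: derivative_eq_intros)
  ultimately show ?thesis by simp
qed

lemma arcsinh_p_has_real_derivative_hypot_p:
  "0 < s \<Longrightarrow> (arcsinh_p p has_real_derivative 1 / hypot_p s) (at s)"
  using arcsinh_p_has_real_derivative[of s] by (simp add: hypot_p_def powr_minus_divide)

lemma powr_p_tendsto_0: "((\<lambda>s. s powr p) \<longlongrightarrow> 0) (at_right 0)"
proof -
  have "((\<lambda>s::real. s powr p) \<longlongrightarrow> 0 powr p) (at_right 0)"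
    using p eventually_at_right_less[of "0::real"]
    by (intro tendsto_powr' tendsto_ident_at tendsto_const) (auto elim: eventually_mono)
  then show ?thesis by simp
qed

lemma hypot_p_tendsto_1: "(hypot_p \<longlongrightarrow> 1) (at_right 0)"
  using tendsto_powr[OF tendsto_add[OF tendsto_const[of 1] powr_p_tendsto_0] tendsto_const[of "1 / p"]]
  by (simp add: hypot_p_def[abs_def])

text \<open>The quotient of the derivatives is \<open>hypot_p\<close>, which increases.\<close>

lemma ratio_arcsinh_p_strict_mono: "strict_mono_on {0<..} (\<lambda>s. s / arcsinh_p p s)"
proof (rule strict_mono_on_quotient_of_deriv_quotient)
  show "((\<lambda>s. s) has_real_derivative 1) (at s)" for s :: real by simp
  show "strict_mono_on {0<..} (\<lambda>s. 1 / (1 / hypot_p s))"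
    using p by (auto intro!: strict_mono_onI simp: hypot_p_def powr_less_mono2)
qed (use hypot_p_gt_1 arcsinh_p_tendsto_0 arcsinh_p_has_real_derivative_hypot_p in \<open>auto intro: less_trans[of 0 1]\<close>)

text \<open>By l'Hopital's rule the limit is that of \<open>hypot_p\<close> at
  \<open>0\<close>.\<close>

lemma ratio_arcsinh_p_tendsto_1: "((\<lambda>s. s / arcsinh_p p s) \<longlongrightarrow> 1) (at_right 0)"
proof (rule lhopital_right_0[where f' = "\<lambda>_. 1" and g' = "\<lambda>s. 1 / hypot_p s"])
  note ev = eventually_at_right_less[of "0::real"]
  show "\<forall>\<^sub>F s in at_right 0. arcsinh_p p s \<noteq> 0"
    using ev by eventually_elim (use arcsinh_p_pos in force)
  show "\<forall>\<^sub>F s in at_right 0. 1 / hypot_p s \<noteq> 0"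
    using ev by eventually_elim (use hypot_p_gt_1 in force)
  show "\<forall>\<^sub>F s in at_right 0. (arcsinh_p p has_real_derivative 1 / hypot_p s) (at s)"
    using ev by eventually_elim (rule arcsinh_p_has_real_derivative_hypot_p)
qed (use arcsinh_p_tendsto_0 hypot_p_tendsto_1 in auto)

lemma id_div_hypot_p_has_real_derivative:
  assumes "0 < s"
  shows "((\<lambda>s. s / hypot_p s) has_real_derivative 1 / (hypot_p s * (1 + s powr p))) (at s)"
proof -
  have "1 + s powr p \<noteq> 0" "hypot_p s \<noteq> 0" using hypot_p_gt_1[OF assms] by (auto simp: less_imp_neq[symmetric])
  then have "(1 * hypot_p s - s * (hypot_p s * s powr p / (s * (1 + s powr p)))) / (hypot_p s * hypot_p s)
      = 1 / (hypot_p s * (1 + s powr p))"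
    using assms by (simp add: divide_simps) (simp add: algebra_simps)
  moreover have "((\<lambda>s. s / hypot_p s) has_real_derivative
      (1 * hypot_p s - s * (hypot_p s * s powr p / (s * (1 + s powr p)))) / (hypot_p s * hypot_p s)) (at s)"
    using hypot_p_gt_1[OF assms] by (intro DERIV_divide DERIV_ident hypot_p_has_real_derivative assms) auto
  ultimately show ?thesis by simp
qed

lemma weight_has_real_derivative:
  assumes "0 < s"
  shows "((\<lambda>s. s powr p / (1 + s powr p)) has_real_derivative
    p * s powr p / (s * (1 + s powr p)\<^sup>2)) (at s)"
proof -
  have "1 + s powr p \<noteq> 0" by (auto simp: less_imp_neq[symmetric])
  then have "(p * s powr (p - 1) * (1 + s powr p) - s powr p * (p * s powr (p - 1)))
      / ((1 + s powr p) * (1 + s powr p)) = p * s powr p / (s * (1 + s powr p)\<^sup>2)"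
    using assms by (simp add: powr_diff divide_simps power2_eq_square) (simp add: algebra_simps)
  moreover have "((\<lambda>s. s powr p / (1 + s powr p)) has_real_derivative
      (p * s powr (p - 1) * (1 + s powr p) - s powr p * (p * s powr (p - 1)))
      / ((1 + s powr p) * (1 + s powr p))) (at s)"
    using assms \<open>1 + s powr p \<noteq> 0\<close> by (intro DERIV_divide) (auto intro!: derivative_eq_intros)
  ultimately show ?thesis by simp
qed

section \<open>The first quotient of derivatives: monotonicity and limits\<close>

text \<open>For \<open>s > 0\<close>, multiplying \<open>outer_num' s\<close> and
  \<open>outer_den' s\<close> below by \<open>s * arcsinh_p p s\<close> gives
  \<open>inner_num s\<close> and \<open>inner_den s\<close>. Both tend to \<open>0\<close> at
  \<open>0\<close>, so the rule can be applied again.\<close>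

definition inner_num :: "real \<Rightarrow> real" where
  "inner_num s = arcsinh_p p s - s / hypot_p s"

definition inner_den :: "real \<Rightarrow> real" where
  "inner_den s = s powr p / (1 + s powr p) * arcsinh_p p s"

definition inner_num' :: "real \<Rightarrow> real" where
  "inner_num' s = s powr p / (hypot_p s * (1 + s powr p))"

definition inner_den' :: "real \<Rightarrow> real" where
  "inner_den' s = p * s powr p / (s * (1 + s powr p)\<^sup>2) * arcsinh_p p s
     + s powr p / (1 + s powr p) * (1 / hypot_p s)"

lemma inner_num_has_real_derivative:
  assumes "0 < s"
  shows "(inner_num has_real_derivative inner_num' s) (at s)"
proof -
  \<comment> \<open>Over the common denominator the numerator is
    \<open>(1 + s powr p) - 1\<close>.\<close>
  have "1 / hypot_p s - 1 / (hypot_p s * (1 + s powr p)) = inner_num' s"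
    using hypot_p_gt_1[OF assms] one_plus_powr_pos[of s]
    by (simp add: inner_num'_def divide_simps less_imp_neq[symmetric])
  then show ?thesis
    using DERIV_diff[OF arcsinh_p_has_real_derivative_hypot_p[OF assms]
        id_div_hypot_p_has_real_derivative[OF assms]]
    by (simp add: inner_num_def[abs_def])
qed

lemma inner_den_has_real_derivative:
  "0 < s \<Longrightarrow> (inner_den has_real_derivative inner_den' s) (at s)"
  unfolding inner_den_def[abs_def] inner_den'_def
  using DERIV_mult[OF weight_has_real_derivative arcsinh_p_has_real_derivative_hypot_p]
  by (simp add: mult.commute)

lemma inner_den_pos:
  assumes "0 < s"
  shows "0 < inner_den' s" "0 < inner_den s"
proof -
  have "0 < hypot_p s" using hypot_p_gt_1[OF assms] by simp
  moreover have "0 < s powr p" using assms by simp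
  ultimately show "0 < inner_den' s" "0 < inner_den s"
    using assms p arcsinh_p_pos[OF assms] one_plus_powr_pos[of s]
    unfolding inner_den'_def inner_den_def
    by (auto intro!: divide_pos_pos mult_pos_pos add_pos_pos zero_less_power
        simp del: one_plus_powr_pos)
qed

lemma inner_num_tendsto_0: "(inner_num \<longlongrightarrow> 0) (at_right 0)"
  using tendsto_diff[OF arcsinh_p_tendsto_0 tendsto_divide[OF tendsto_ident_at hypot_p_tendsto_1]]
  by (simp add: inner_num_def[abs_def])

lemma inner_den_tendsto_0: "(inner_den \<longlongrightarrow> 0) (at_right 0)"
  using tendsto_mult[OF tendsto_divide[OF powr_p_tendsto_0
        tendsto_add[OF tendsto_const[of 1] powr_p_tendsto_0]] arcsinh_p_tendsto_0]
  by (simp add: inner_den_def[abs_def])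

text \<open>In this form \<open>s\<close> enters only through a product of two increasing factors,
  each tending to \<open>1\<close> at \<open>0\<close>; both the monotonicity and the limit follow
  from that.\<close>

lemma inner_deriv_quotient:
  assumes "0 < s"
  shows "inner_num' s / inner_den' s
    = 1 / (1 + p / (s / arcsinh_p p s * (1 + s powr p) powr (1 - 1 / p)))"
proof -
  define P K A where "P = s powr p" and "K = 1 + P" and "A = arcsinh_p p s"
  have pos: "0 < P" "0 < K" "0 < A" "0 < hypot_p s"
    using assms hypot_p_gt_1[OF assms] arcsinh_p_pos[OF assms] by (auto simp: P_def K_def A_def)
  \<comment> \<open>\<open>D\<close> appears when the two terms of \<open>inner_den' s\<close> are
    put over the denominator \<open>s * K\<^sup>2 * hypot_p s\<close> and \<open>P\<close> is
    factored out.\<close>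
  define D where "D = s * K + p * A * hypot_p s"
  have D: "0 < D"
    unfolding D_def using pos assms p by (intro add_pos_pos mult_pos_pos) auto
  have "K powr (1 - 1 / p) = K / hypot_p s"
    using pos by (simp add: powr_diff hypot_p_def K_def P_def)
  moreover have "1 / (1 + p / (s / A * (K / hypot_p s))) = s * K / D"
    using pos assms p by (simp add: D_def field_simps)
  moreover have "inner_den' s = P * D / (s * K\<^sup>2 * hypot_p s)"
    using pos assms unfolding inner_den'_def P_def[symmetric] K_def[symmetric] A_def[symmetric]
    by (simp add: D_def field_simps power2_eq_square)
  moreover have "inner_num' s = P / (hypot_p s * K)"
    by (simp add: inner_num'_def P_def K_def)
  moreover have "P / (hypot_p s * K) / (P * D / (s * K\<^sup>2 * hypot_p s)) = s * K / D"
    using pos assms D by (simp add: field_simps power2_eq_square)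
  ultimately show ?thesis
    unfolding P_def[symmetric] K_def[symmetric] A_def[symmetric] by simp
qed

text \<open>The product \<open>c\<close> increases because \<open>s / arcsinh_p p s\<close> does and
  because \<open>1 - 1 / p\<close> is positive; \<open>1 / (1 + p / c)\<close> increases with
  \<open>c\<close>.\<close>

lemma inner_quotient_strict_mono: "strict_mono_on {0<..} (\<lambda>s. inner_num s / inner_den s)"
proof (rule strict_mono_on_quotient_of_deriv_quotient[OF inner_num_tendsto_0 inner_den_tendsto_0
      inner_num_has_real_derivative inner_den_has_real_derivative inner_den_pos(1)])
  show "strict_mono_on {0<..} (\<lambda>s. inner_num' s / inner_den' s)"
  proof (rule strict_mono_onI)
    fix s t :: real assume st: "s \<in> {0<..}" "t \<in> {0<..}" "s < t"
    define c where "c s = s / arcsinh_p p s * (1 + s powr p) powr (1 - 1 / p)" for s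
    have "0 < c s"
      unfolding c_def using st arcsinh_p_pos[of s] one_plus_powr_pos[of s]
      by (intro mult_pos_pos divide_pos_pos) (auto simp del: one_plus_powr_pos)
    moreover have "c s < c t"
      unfolding c_def
    proof (rule mult_strict_mono)
      show "s / arcsinh_p p s < t / arcsinh_p p t"
        using st by (intro strict_mono_onD[OF ratio_arcsinh_p_strict_mono]) auto
      show "(1 + s powr p) powr (1 - 1 / p) < (1 + t powr p) powr (1 - 1 / p)"
        using st p by (intro powr_less_mono2) (auto intro!: powr_less_mono2 less_imp_le)
    qed (use st arcsinh_p_pos in \<open>auto intro!: divide_pos_pos\<close>)
    ultimately have "p / c t < p / c s" "0 < p / c t"
      using p by (auto intro!: divide_strict_left_mono mult_pos_pos)
    then have "1 / (1 + p / c s) < 1 / (1 + p / c t)"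
      by (intro divide_strict_left_mono mult_pos_pos) auto
    then show "inner_num' s / inner_den' s < inner_num' t / inner_den' t"
      using st by (simp add: inner_deriv_quotient c_def)
  qed
qed

lemma inner_quotient_tendsto:
  "((\<lambda>s. inner_num s / inner_den s) \<longlongrightarrow> 1 / (1 + p)) (at_right 0)"
proof (rule lhopital_right_0[OF inner_num_tendsto_0 inner_den_tendsto_0])
  note ev = eventually_at_right_less[of "0::real"]
  show "\<forall>\<^sub>F s in at_right 0. inner_den s \<noteq> 0"
    using ev by eventually_elim (use inner_den_pos in force)
  show "\<forall>\<^sub>F s in at_right 0. inner_den' s \<noteq> 0"
    using ev by eventually_elim (use inner_den_pos in force)
  show "\<forall>\<^sub>F s in at_right 0. (inner_num has_real_derivative inner_num' s) (at s)"
    using ev by eventually_elim (rule inner_num_has_real_derivative)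
  show "\<forall>\<^sub>F s in at_right 0. (inner_den has_real_derivative inner_den' s) (at s)"
    using ev by eventually_elim (rule inner_den_has_real_derivative)
  have "((\<lambda>s. (1 + s powr p) powr (1 - 1 / p)) \<longlongrightarrow> 1) (at_right 0)"
    using tendsto_powr[OF tendsto_add[OF tendsto_const[of 1] powr_p_tendsto_0]
        tendsto_const[of "1 - 1 / p"]] by simp
  then have "((\<lambda>s. 1 / (1 + p / (s / arcsinh_p p s * (1 + s powr p) powr (1 - 1 / p))))
      \<longlongrightarrow> 1 / (1 + p / (1 * 1))) (at_right 0)"
    using p by (intro tendsto_intros ratio_arcsinh_p_tendsto_1) auto
  then have lim: "((\<lambda>s. 1 / (1 + p / (s / arcsinh_p p s * (1 + s powr p) powr (1 - 1 / p))))
      \<longlongrightarrow> 1 / (1 + p)) (at_right 0)" by simp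
  show "((\<lambda>s. inner_num' s / inner_den' s) \<longlongrightarrow> 1 / (1 + p)) (at_right 0)"
    by (rule Lim_transform_eventually[OF lim])
      (use ev in \<open>eventually_elim, simp add: inner_deriv_quotient\<close>)
qed

text \<open>Divide numerator and denominator by \<open>arcsinh_p p s\<close>. The term
  \<open>s / hypot_p s\<close> stays in \<open>[0, 1]\<close> while \<open>arcsinh_p p s\<close>
  diverges, so the numerator tends to \<open>1\<close>, as does the weight
  \<open>s powr p / (1 + s powr p)\<close>.\<close>

lemma inner_quotient_tendsto_at_top:
  "((\<lambda>s. inner_num s / inner_den s) \<longlongrightarrow> 1) at_top"
proof -
  have "filterlim (\<lambda>s. s powr p) at_top at_top"
  proof (rule filterlim_at_top_mono[OF filterlim_ident])
    show "\<forall>\<^sub>F s in at_top. s \<le> s powr p"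
      using eventually_ge_at_top[of 1]
      by eventually_elim (use p powr_mono[of 1 p] in force)
  qed
  then have K: "filterlim (\<lambda>s. 1 + s powr p) at_top at_top"
    by (rule filterlim_tendsto_add_at_top[OF tendsto_const])
  have "((\<lambda>s. 1 - 1 / (1 + s powr p)) \<longlongrightarrow> 1 - 0) at_top"
    by (intro tendsto_diff tendsto_const tendsto_divide_0[OF tendsto_const]
        filterlim_at_top_imp_at_infinity K)
  moreover have "1 - 1 / (1 + s powr p) = s powr p / (1 + s powr p)" for s
    using one_plus_powr_pos[of s] by (simp add: field_simps del: one_plus_powr_pos)
  ultimately have w: "((\<lambda>s. s powr p / (1 + s powr p)) \<longlongrightarrow> 1) at_top" by simp
  have le: "s / hypot_p s \<le> 1" if "0 < s" for s
    using le_hypot_p[OF that] hypot_p_gt_1[OF that] by simp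
  have inv: "((\<lambda>s. 1 / arcsinh_p p s) \<longlongrightarrow> 0) at_top"
    by (intro tendsto_divide_0[OF tendsto_const] filterlim_at_top_imp_at_infinity
        filterlim_arcsinh_p)
  have "((\<lambda>s. s / hypot_p s / arcsinh_p p s) \<longlongrightarrow> 0) at_top"
  proof (rule tendsto_sandwich[OF _ _ tendsto_const inv])
    show "\<forall>\<^sub>F s in at_top. 0 \<le> s / hypot_p s / arcsinh_p p s"
      using eventually_gt_at_top[of 0]
      by eventually_elim (use arcsinh_p_pos hypot_p_gt_1 in \<open>force intro!: divide_nonneg_pos\<close>)
    show "\<forall>\<^sub>F s in at_top. s / hypot_p s / arcsinh_p p s \<le> 1 / arcsinh_p p s"
      using eventually_gt_at_top[of 0]
      by eventually_elim (intro divide_right_mono le less_imp_le[OF arcsinh_p_pos])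
  qed
  then have lim: "((\<lambda>s. (1 - s / hypot_p s / arcsinh_p p s) / (s powr p / (1 + s powr p))) \<longlongrightarrow> (1 - 0) / 1) at_top"
    by (intro tendsto_intros w) auto
  have "\<forall>\<^sub>F s in at_top. (1 - s / hypot_p s / arcsinh_p p s) / (s powr p / (1 + s powr p))
      = inner_num s / inner_den s"
    using eventually_gt_at_top[of 0]
  proof eventually_elim
    case (elim s)
    then have "inner_num s = (1 - s / hypot_p s / arcsinh_p p s) * arcsinh_p p s"
      using arcsinh_p_pos[of s] by (simp add: inner_num_def left_diff_distrib)
    then show ?case using arcsinh_p_pos[OF elim] by (simp add: inner_den_def)
  qed
  from Lim_transform_eventually[OF lim this] show ?thesis by simp
qed

section \<open>The quotient of logarithms in the variable \<open>s\<close>: monotonicity, limits and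
  range\<close>

definition outer_num :: "real \<Rightarrow> real" where
  "outer_num s = ln (s / arcsinh_p p s)"

definition outer_den :: "real \<Rightarrow> real" where
  "outer_den s = ln (hypot_p s)"

definition outer_num' :: "real \<Rightarrow> real" where
  "outer_num' s = 1 / s - 1 / (hypot_p s * arcsinh_p p s)"

definition outer_den' :: "real \<Rightarrow> real" where
  "outer_den' s = s powr p / (s * (1 + s powr p))"

lemma outer_num_has_real_derivative:
  assumes "0 < s"
  shows "(outer_num has_real_derivative outer_num' s) (at s)"
proof -
  have "((\<lambda>s. ln s - ln (arcsinh_p p s)) has_real_derivative
      1 / s - 1 / arcsinh_p p s * (1 / hypot_p s)) (at s)"
    using assms arcsinh_p_pos[OF assms]
    by (intro DERIV_diff DERIV_chain2[OF DERIV_ln_divide] arcsinh_p_has_real_derivative_hypot_p DERIV_ln_divide)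
  \<comment> \<open>The logarithm of the ratio is split only at positive arguments; agreement near
    \<open>s\<close> is enough to transfer the derivative.\<close>
  moreover have "\<forall>\<^sub>F s in nhds s. ln s - ln (arcsinh_p p s) = outer_num s"
  proof -
    have "\<forall>\<^sub>F x in nhds s. x \<in> {0<..}"
      by (rule eventually_nhds_in_open) (use assms in auto)
    then show ?thesis
      by eventually_elim (simp add: outer_num_def ln_divide_pos arcsinh_p_pos)
  qed
  ultimately show ?thesis
    by (subst DERIV_cong_ev[OF refl _ refl, symmetric]) (auto simp: outer_num'_def mult.commute)
qed

lemma outer_den_has_real_derivative:
  assumes "0 < s"
  shows "(outer_den has_real_derivative outer_den' s) (at s)"
  using DERIV_chain2[OF DERIV_ln_divide hypot_p_has_real_derivative[OF assms]] hypot_p_gt_1[OF assms] assms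
  by (simp add: outer_den_def[abs_def] outer_den'_def)

lemma outer_den'_pos: "0 < s \<Longrightarrow> 0 < outer_den' s"
  unfolding outer_den'_def by (intro divide_pos_pos mult_pos_pos) auto

lemma outer_den_pos: "0 < s \<Longrightarrow> 0 < outer_den s"
  using hypot_p_gt_1[of s] by (simp add: outer_den_def)

lemma outer_num_tendsto_0: "(outer_num \<longlongrightarrow> 0) (at_right 0)"
  using tendsto_ln[OF ratio_arcsinh_p_tendsto_1] by (simp add: outer_num_def[abs_def])

lemma outer_den_tendsto_0: "(outer_den \<longlongrightarrow> 0) (at_right 0)"
  using tendsto_ln[OF hypot_p_tendsto_1] by (simp add: outer_den_def[abs_def])

lemma outer_deriv_quotient:
  assumes "0 < s"
  shows "outer_num' s / outer_den' s = inner_num s / inner_den s"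
  using assms hypot_p_gt_1[OF assms] arcsinh_p_pos[OF assms] one_plus_powr_pos[of s]
  unfolding outer_num'_def outer_den'_def inner_num_def inner_den_def
  by (simp add: divide_simps less_imp_neq[symmetric] del: one_plus_powr_pos)

lemma outer_quotient_strict_mono: "strict_mono_on {0<..} (\<lambda>s. outer_num s / outer_den s)"
proof (rule strict_mono_on_quotient_of_deriv_quotient[OF outer_num_tendsto_0 outer_den_tendsto_0
      outer_num_has_real_derivative outer_den_has_real_derivative outer_den'_pos])
  show "strict_mono_on {0<..} (\<lambda>s. outer_num' s / outer_den' s)"
    using inner_quotient_strict_mono by (simp add: strict_mono_on_def outer_deriv_quotient)
qed

lemma outer_quotient_tendsto:
  "((\<lambda>s. outer_num s / outer_den s) \<longlongrightarrow> 1 / (1 + p)) (at_right 0)"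
proof (rule lhopital_right_0[OF outer_num_tendsto_0 outer_den_tendsto_0])
  note ev = eventually_at_right_less[of "0::real"]
  show "\<forall>\<^sub>F s in at_right 0. outer_den s \<noteq> 0"
    using ev by eventually_elim (use outer_den_pos in force)
  show "\<forall>\<^sub>F s in at_right 0. outer_den' s \<noteq> 0"
    using ev by eventually_elim (use outer_den'_pos in force)
  show "\<forall>\<^sub>F s in at_right 0. (outer_num has_real_derivative outer_num' s) (at s)"
    using ev by eventually_elim (rule outer_num_has_real_derivative)
  show "\<forall>\<^sub>F s in at_right 0. (outer_den has_real_derivative outer_den' s) (at s)"
    using ev by eventually_elim (rule outer_den_has_real_derivative)
  show "((\<lambda>s. outer_num' s / outer_den' s) \<longlongrightarrow> 1 / (1 + p)) (at_right 0)"
    by (rule Lim_transform_eventually[OF inner_quotient_tendsto])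
      (use ev in \<open>eventually_elim, simp add: outer_deriv_quotient\<close>)
qed

text \<open>This version of l'Hopital's rule asks for divergence of the denominator, which follows
  from \<open>s \<le> hypot_p s\<close>; the quotient of derivatives is the inner one, with limit
  \<open>1\<close>.\<close>

lemma outer_quotient_tendsto_at_top:
  "((\<lambda>s. outer_num s / outer_den s) \<longlongrightarrow> 1) at_top"
proof (rule lhospital_at_top_at_top)
  note ev = eventually_gt_at_top[of "0::real"]
  have q: "filterlim hypot_p at_top at_top"
    by (rule filterlim_at_top_mono[OF filterlim_ident])
      (use ev in \<open>eventually_elim, simp add: le_hypot_p\<close>)
  show "filterlim outer_den at_top at_top"
    using filterlim_compose[OF ln_at_top q] by (simp add: outer_den_def[abs_def])
  show "\<forall>\<^sub>F s in at_top. outer_den' s \<noteq> 0"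
    using ev by eventually_elim (use outer_den'_pos in force)
  show "\<forall>\<^sub>F s in at_top. (outer_num has_real_derivative outer_num' s) (at s)"
    using ev by eventually_elim (rule outer_num_has_real_derivative)
  show "\<forall>\<^sub>F s in at_top. (outer_den has_real_derivative outer_den' s) (at s)"
    using ev by eventually_elim (rule outer_den_has_real_derivative)
  show "((\<lambda>s. outer_num' s / outer_den' s) \<longlongrightarrow> 1) at_top"
    by (rule Lim_transform_eventually[OF inner_quotient_tendsto_at_top])
      (use ev in \<open>eventually_elim, simp add: outer_deriv_quotient\<close>)
qed

lemma outer_quotient_image: "(\<lambda>s. outer_num s / outer_den s) ` {0<..} = {1 / (1 + p)<..<1}"
proof (rule strict_mono_on_image_greaterThan[OF outer_quotient_strict_mono _
      outer_quotient_tendsto outer_quotient_tendsto_at_top])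
  show "continuous_on {0<..} (\<lambda>s. outer_num s / outer_den s)"
  proof (intro continuous_on_divide ballI)
    show "continuous_on {0<..} outer_num"
      by (rule DERIV_continuous_on[OF has_field_derivative_at_within])
        (auto intro: outer_num_has_real_derivative)
    show "continuous_on {0<..} outer_den"
      by (rule DERIV_continuous_on[OF has_field_derivative_at_within])
        (auto intro: outer_den_has_real_derivative)
    show "outer_den s \<noteq> 0" if "s \<in> {0<..}" for s
      using outer_den_pos[of s] that by simp
  qed
qed

section \<open>Return to the variable \<open>x = arcsinh_p p s\<close>\<close>

lemma sinh_p_cosh_p_quotient:
  assumes "0 < s"
  shows "ln (sinh_p p (arcsinh_p p s) / arcsinh_p p s) / ln (cosh_p p (arcsinh_p p s))
    = outer_num s / outer_den s"
  using assms by (simp add: sinh_p_arcsinh_p cosh_p_arcsinh_p outer_num_def outer_den_def hypot_p_def)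

lemma arcsinh_p_cases:
  assumes "0 < x" obtains s where "0 < s" "x = arcsinh_p p s"
proof -
  have "x \<in> arcsinh_p p ` {0..}" using arcsinh_p_bij assms by (simp add: bij_betw_def)
  then obtain s where "0 \<le> s" "x = arcsinh_p p s" by auto
  moreover have "0 < s"
    using calculation assms by (cases "s = 0") auto
  ultimately show ?thesis using that by blast
qed

lemma cosh_p_gt_1: "0 < x \<Longrightarrow> 1 < cosh_p p x"
  using hypot_p_gt_1 cosh_p_arcsinh_p by (metis arcsinh_p_cases hypot_p_def)

lemma sinh_p_div_pos: "0 < x \<Longrightarrow> 0 < sinh_p p x / x"
  using sinh_p_arcsinh_p by (metis arcsinh_p_cases divide_pos_pos less_imp_le)

lemma strict_mono_sinh_p_cosh_p:
  "strict_mono_on {0<..} (\<lambda>x. ln (sinh_p p x / x) / ln (cosh_p p x))"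
proof (rule strict_mono_onI)
  fix x y :: real assume xy: "x \<in> {0<..}" "y \<in> {0<..}" "x < y"
  obtain s t where st: "0 < s" "x = arcsinh_p p s" "0 < t" "y = arcsinh_p p t"
    using xy arcsinh_p_cases by (metis greaterThan_iff)
  then have "s < t"
    using strict_mono_on_less[OF arcsinh_p_strict_mono, of s t] xy by simp
  then show "ln (sinh_p p x / x) / ln (cosh_p p x) < ln (sinh_p p y / y) / ln (cosh_p p y)"
    using st strict_mono_onD[OF outer_quotient_strict_mono, of s t]
    by (simp add: sinh_p_cosh_p_quotient)
qed

text \<open>The substitution maps the positive reals onto themselves, so it does not change the
  range.\<close>

lemma image_sinh_p_cosh_p:
  "(\<lambda>x. ln (sinh_p p x / x) / ln (cosh_p p x)) ` {0<..} = {1 / (1 + p)<..<1}"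
proof -
  have dom: "arcsinh_p p ` {0<..} = {0<..}"
    using arcsinh_p_pos arcsinh_p_cases by (auto, blast)
  have "(\<lambda>x. ln (sinh_p p x / x) / ln (cosh_p p x)) ` arcsinh_p p ` {0<..}
      = (\<lambda>s. outer_num s / outer_den s) ` {0<..}"
    unfolding image_image by (rule image_cong) (simp_all add: sinh_p_cosh_p_quotient)
  then show ?thesis by (simp only: dom outer_quotient_image)
qed

text \<open>Take logarithms and divide by \<open>ln (cosh_p p x)\<close>, which is positive. Bounds
  with a given exponent thus become statements about the range of the quotient.\<close>

lemma powr_less_sinh_p_iff:
  assumes "0 < x"
  shows "cosh_p p x powr a < sinh_p p x / x \<longleftrightarrow> a < ln (sinh_p p x / x) / ln (cosh_p p x)"
proof -
  have c: "1 < cosh_p p x" using cosh_p_gt_1[OF assms] .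
  have "cosh_p p x powr a < sinh_p p x / x \<longleftrightarrow> ln (cosh_p p x powr a) < ln (sinh_p p x / x)"
    using c sinh_p_div_pos[OF assms] by (subst ln_less_cancel_iff) auto
  also have "\<dots> \<longleftrightarrow> a < ln (sinh_p p x / x) / ln (cosh_p p x)"
    using c by (simp add: ln_powr pos_less_divide_eq)
  finally show ?thesis .
qed

lemma sinh_p_less_powr_iff:
  assumes "0 < x"
  shows "sinh_p p x / x < cosh_p p x powr b \<longleftrightarrow> ln (sinh_p p x / x) / ln (cosh_p p x) < b"
proof -
  have c: "1 < cosh_p p x" using cosh_p_gt_1[OF assms] .
  have "sinh_p p x / x < cosh_p p x powr b \<longleftrightarrow> ln (sinh_p p x / x) < ln (cosh_p p x powr b)"
    using c sinh_p_div_pos[OF assms] by (subst ln_less_cancel_iff) auto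
  also have "\<dots> \<longleftrightarrow> ln (sinh_p p x / x) / ln (cosh_p p x) < b"
    using c by (simp add: ln_powr pos_divide_less_eq)
  finally show ?thesis .
qed

end

theorem theorem3p8:
  fixes p :: real
  assumes "1 < p"
  shows "strict_mono_on {0<..} (\<lambda>x. ln (sinh_p p x / x) / ln (cosh_p p x)) \<and>
    (\<lambda>x. ln (sinh_p p x / x) / ln (cosh_p p x)) ` {0<..} = {1 / (1 + p)<..<1} \<and>
    (\<forall>x>0. cosh_p p x powr (1 / (1 + p)) < sinh_p p x / x \<and>
           sinh_p p x / x < cosh_p p x powr 1) \<and>
    (\<forall>\<alpha>::real. (\<forall>x>0. cosh_p p x powr \<alpha> < sinh_p p x / x) \<longrightarrow> \<alpha> \<le> 1 / (1 + p)) \<and>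
    (\<forall>\<beta>::real. (\<forall>x>0. sinh_p p x / x < cosh_p p x powr \<beta>) \<longrightarrow> 1 \<le> \<beta>)"
proof (intro conjI allI impI)
  define f where "f x = ln (sinh_p p x / x) / ln (cosh_p p x)" for x
  have img: "f ` {0<..} = {1 / (1 + p)<..<1}"
    unfolding f_def by (rule image_sinh_p_cosh_p[OF assms])
  have less: "1 / (1 + p) < 1" using assms by simp
  have bounds: "1 / (1 + p) < f x" "f x < 1" if "0 < x" for x
    using img that by (force simp: set_eq_iff)+
  have surj: "\<exists>x>0. f x = y" if "1 / (1 + p) < y" "y < 1" for y
  proof -
    have "y \<in> f ` {0<..}" using img that by simp
    then show ?thesis by auto
  qed
  note lower = powr_less_sinh_p_iff[OF assms, folded f_def]
  note upper = sinh_p_less_powr_iff[OF assms, folded f_def]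
  show "strict_mono_on {0<..} (\<lambda>x. ln (sinh_p p x / x) / ln (cosh_p p x))"
    by (rule strict_mono_sinh_p_cosh_p[OF assms])
  show "(\<lambda>x. ln (sinh_p p x / x) / ln (cosh_p p x)) ` {0<..} = {1 / (1 + p)<..<1}"
    by (rule image_sinh_p_cosh_p[OF assms])
  show "cosh_p p x powr (1 / (1 + p)) < sinh_p p x / x" if "0 < x" for x
    using lower[OF that] bounds(1)[OF that] by simp
  show "sinh_p p x / x < cosh_p p x powr 1" if "0 < x" for x
    using upper[OF that] bounds(2)[OF that] by blast
  show "\<alpha> \<le> 1 / (1 + p)" if "\<forall>x>0. cosh_p p x powr \<alpha> < sinh_p p x / x" for \<alpha>
  proof (rule ccontr)
    have a: "\<alpha> < f x" if "0 < x" for x using lower \<open>\<forall>x>0. _ x\<close> that by blast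
    assume "\<not> \<alpha> \<le> 1 / (1 + p)"
    \<comment> \<open>The sample point \<open>1\<close> gives \<open>\<alpha> < f 1 < 1\<close>. So
      \<open>\<alpha>\<close> lies in the range of \<open>f\<close>, and a point where it is
      attained contradicts \<open>a\<close>.\<close>
    moreover have "\<alpha> < 1" using a[of 1] bounds(2)[of 1] by simp
    ultimately obtain x where "0 < x" "f x = \<alpha>" using surj[of \<alpha>] by auto
    then show False using a[of x] by simp
  qed
  show "1 \<le> \<beta>" if "\<forall>x>0. sinh_p p x / x < cosh_p p x powr \<beta>" for \<beta>
  proof (rule ccontr)
    have b: "f x < \<beta>" if "0 < x" for x using upper \<open>\<forall>x>0. _ x\<close> that by blast
    assume "\<not> 1 \<le> \<beta>"
    \<comment> \<open>Dually, \<open>1 / (1 + p) < f 1 < \<beta>\<close> makes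
      \<open>\<beta>\<close> a value of \<open>f\<close>, against \<open>b\<close>.\<close>
    moreover have "1 / (1 + p) < \<beta>" using b[of 1] bounds(1)[of 1] by simp
    ultimately obtain x where "0 < x" "f x = \<beta>" using surj[of \<beta>] by auto
    then show False using b[of x] by simp
  qed
qed

end
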